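(* Let $S=A+B$ with $A=QQ^*\in\mathbb{C}^{n\times n}$ Hermitian positive definite, $Q\in\mathbb{C}^{n\times n}$, and $B\in\mathbb{C}^{n\times n}$ Hermitian positive semidefinite, let $G=Q^{-1}BQ^{-*}$, let $r<\operatorname{rank}(B)$ be a positive integer, let $G_r$ be a rank-$r$ truncated SVD of $G$, and let $\widehat S_r=Q(I+G_r)Q^*$. Let $\|\cdot\|$ be either the spectral norm or the Frobenius norm. Then $\widehat S_r$ is a minimiser of $$\begin{aligned}\text{minimise over } \mathcal{P}\in\mathbb{H}^n_{++}\quad & \|Q^{-1}(S-\mathcal{P})Q^{-*}\|^2\\ \text{subject to}\quad & \mathcal{P}=Q(I+X)Q^*,\\ &\operatorname{rank}(X)\le r.\end{aligned}$$
   Context: $\mathbb{H}^n_{++}$ denotes the Hermitian positive definite $n\times n$ matrices. $M^*$ is the conjugate transpose, $M^{-*}=(M^{-1})^*$. A rank-$r$ truncated SVD of a Hermitian positive semidefinite $M=\sum_{i}\lambda_i(M)v_iv_i^*$ ($v_i$ orthonormal eigenvectors, eigenvalues $\lambda_i(M)$ in nonincreasing order) is $M_r=\sum_{i=1}^r\lambda_i(M)v_iv_i^*$. *)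

theory Defs
  imports "HOL-Analysis.Analysis"
begin

definition conj_transpose :: "complex^'n^'m \<Rightarrow> complex^'m^'n" where
  "conj_transpose M = (\<chi> i j. cnj (M $ j $ i))"

definition cinner :: "complex^'n \<Rightarrow> complex^'n \<Rightarrow> complex" where
  "cinner x y = (\<Sum>i\<in>UNIV. cnj (x $ i) * y $ i)"

definition hermitian :: "complex^'n^'n \<Rightarrow> bool" where
  "hermitian M \<longleftrightarrow> conj_transpose M = M"

(* For Hermitian M the form cinner x (M *v x) is real, so taking Re below loses nothing. *)

definition hermitian_psd :: "complex^'n^'n \<Rightarrow> bool" where
  "hermitian_psd M \<longleftrightarrow> hermitian M \<and> (\<forall>x. 0 \<le> Re (cinner x (M *v x)))"

definition hermitian_pd :: "complex^'n^'n \<Rightarrow> bool" where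
  "hermitian_pd M \<longleftrightarrow> hermitian M \<and> (\<forall>x. x \<noteq> 0 \<longrightarrow> 0 < Re (cinner x (M *v x)))"

(* The rank-one matrix v v^* *)
definition outer_self :: "complex^'n \<Rightarrow> complex^'n^'n" where
  "outer_self v = (\<chi> i j. v $ i * cnj (v $ j))"

(* Eigenpairs are numbered 0, ..., n - 1 with n = CARD('n); values of lam and v beyond
   that are irrelevant.  *)
definition eigen_decomposition ::
    "complex^'n^'n \<Rightarrow> (nat \<Rightarrow> real) \<Rightarrow> (nat \<Rightarrow> complex^'n) \<Rightarrow> bool" where
  "eigen_decomposition M lam v \<longleftrightarrow>
     (\<forall>i<CARD('n). \<forall>j<CARD('n). cinner (v i) (v j) = (if i = j then 1 else 0)) \<and>
     (\<forall>i<CARD('n). M *v v i = complex_of_real (lam i) *s v i) \<and>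
     (\<forall>i<CARD('n). \<forall>j<CARD('n). i \<le> j \<longrightarrow> lam j \<le> lam i) \<and>
     M = (\<Sum>i<CARD('n). lam i *\<^sub>R outer_self (v i))"

(* A relation, since M_r depends on the choice of eigenvectors when the r-th and (r+1)-th
   eigenvalues coincide.  Meant for positive semidefinite M, where eigenvalues are
   singular values. *)
definition truncated_svd :: "nat \<Rightarrow> complex^'n^'n \<Rightarrow> complex^'n^'n \<Rightarrow> bool" where
  "truncated_svd r M Mr \<longleftrightarrow>
     r \<le> CARD('n) \<and>
     (\<exists>lam v. eigen_decomposition M lam v \<and> Mr = (\<Sum>i<r. lam i *\<^sub>R outer_self (v i)))"

(* The norm on complex^'n is the Euclidean one, so this is the operator 2-norm. *)
definition spectral_norm :: "complex^'n^'n \<Rightarrow> real" where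
  "spectral_norm M = onorm (\<lambda>x. M *v x)"

definition frobenius_norm :: "complex^'n^'n \<Rightarrow> real" where
  "frobenius_norm M = sqrt (\<Sum>i\<in>UNIV. \<Sum>j\<in>UNIV. (cmod (M $ i $ j))\<^sup>2)"

end

theory Submission
  imports Defs
begin

text \<open>
  Write \<open>R\<close> for \<open>Q\<inverse>\<close>. Since \<open>A = Q Q\<^sup>*\<close>, the congruence \<open>M \<mapsto> R M R\<^sup>*\<close> sends
  \<open>S - Q (I + X) Q\<^sup>*\<close> to \<open>G - X\<close>. So the objective at a feasible point is \<open>\<parallel>G - X\<parallel>\<^sup>2\<close> with
  \<open>rank X \<le> r\<close>, and the proposition is the Eckart--Young--Mirsky theorem for the positive
  semidefinite matrix \<open>G\<close>, together with the feasibility of \<open>S\<^sub>r\<close>: the matrix \<open>G\<^sub>r\<close> is again positive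
  semidefinite of rank at most \<open>r\<close>, so \<open>I + G\<^sub>r\<close> and its congruence by \<open>Q\<close> are positive definite.

  Eckart--Young is proved for a linear map \<open>f\<close> of a real Euclidean space that is diagonal in an
  orthonormal basis \<open>e\<close> with nonnegative eigenvalues \<open>mu\<close>, and a linear competitor \<open>g\<close> of rank
  at most \<open>s\<close>. On the orthogonal complement \<open>C\<close> of the range of \<open>g\<close> the competitor is invisible:
  \<open>(f x - g x) \<bullet> w = f x \<bullet> w\<close> for \<open>w\<close> in \<open>C\<close>.

  For the Frobenius norm (\<open>eckart_young_hilbert_schmidt\<close>), let \<open>c i\<close> be the squared length of the
  projection of \<open>e i\<close> to \<open>C\<close>. Projecting \<open>f - g\<close> to \<open>C\<close> bounds the squared norm below by
  \<open>\<Sum>i. (mu i)\<^sup>2 * c i\<close>, where \<open>0 \<le> c i \<le> 1\<close> and the \<open>c i\<close> add up to \<open>dim C\<close>. Such a weighted sum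
  is smallest when the weights sit on the smallest eigenvalues, which gives the tail sum.
  For the spectral norm (\<open>eckart_young_operator_norm\<close>), the span of the \<open>s + 1\<close> leading eigenvectors
  meets \<open>C\<close> in a nonzero vector for dimension reasons; \<open>f\<close> stretches it by at least the
  smallest of these eigenvalues, and \<open>f - g\<close> must have norm at least as large.

  A complex matrix acts as a real linear map on \<open>complex^'n\<close>, a real Euclidean space of dimension
  twice \<open>CARD('n)\<close>. Each complex eigenvector \<open>v\<close> gives the real eigenvectors \<open>v\<close> and \<open>\<i> v\<close> with the
  same eigenvalue, the real dimension of the range is at most twice the complex rank, the spectral
  norm does not change, and the squared Frobenius norm doubles. So the real theorem with \<open>s = 2 r\<close>
  gives the complex one (\<open>eckart_young_complex\<close>).
\<close>

section \<open>Orthonormal families in Euclidean spaces\<close>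

text \<open>
  Indexed families rather than sets of vectors let the eigenvalues be functions of the index,
  so that repeated eigenvalues and the choice of the leading ones need no enumeration.
\<close>

definition orthonormal_family :: "'i set \<Rightarrow> ('i \<Rightarrow> 'a::real_inner) \<Rightarrow> bool" where
  "orthonormal_family I e \<longleftrightarrow> (\<forall>i\<in>I. \<forall>j\<in>I. e i \<bullet> e j = (if i = j then 1 else 0))"

lemma bessel_inequality:
  assumes "finite I" "orthonormal_family I e"
  shows "(\<Sum>i\<in>I. (x \<bullet> e i)\<^sup>2) \<le> (norm x)\<^sup>2"
proof -
  define p where "p = (\<Sum>i\<in>I. (x \<bullet> e i) *\<^sub>R e i)"
  have pe: "e j \<bullet> p = x \<bullet> e j" if "j \<in> I" for j
  proof -
    have "e j \<bullet> p = (\<Sum>i\<in>I. (x \<bullet> e i) * (if j = i then 1 else 0))"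
      unfolding p_def inner_sum_right inner_scaleR_right
      using assms(2) that by (intro sum.cong) (auto simp: orthonormal_family_def)
    also have "\<dots> = x \<bullet> e j"
      using assms(1) that by (simp add: if_distrib cong: if_cong)
    finally show ?thesis .
  qed
  have xp: "x \<bullet> p = (\<Sum>i\<in>I. (x \<bullet> e i)\<^sup>2)"
    by (simp add: p_def inner_sum_right power2_eq_square)
  have "p \<bullet> p = (\<Sum>i\<in>I. (x \<bullet> e i) * (e i \<bullet> p))"
    by (subst p_def) (simp add: inner_sum_left)
  also have "\<dots> = (\<Sum>i\<in>I. (x \<bullet> e i)\<^sup>2)"
    by (intro sum.cong) (auto simp: pe power2_eq_square)
  finally have pp: "p \<bullet> p = (\<Sum>i\<in>I. (x \<bullet> e i)\<^sup>2)" .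
  have "0 \<le> (x - p) \<bullet> (x - p)" by simp
  also have "\<dots> = x \<bullet> x - (\<Sum>i\<in>I. (x \<bullet> e i)\<^sup>2)"
    by (simp add: inner_diff_left inner_diff_right inner_commute[of p x] xp pp)
  finally show ?thesis by (simp add: power2_norm_eq_inner)
qed

lemma orthonormal_family_inj_on:
  assumes "orthonormal_family I e"
  shows "inj_on e I"
  using assms unfolding orthonormal_family_def inj_on_def by (metis zero_neq_one)

lemma orthonormal_family_image:
  assumes "orthonormal_family I e"
  shows "pairwise orthogonal (e ` I)" "\<And>u. u \<in> e ` I \<Longrightarrow> norm u = 1" "0 \<notin> e ` I"
proof -
  have 1: "u \<bullet> u = 1" if "u \<in> e ` I" for u
    using assms that by (auto simp: orthonormal_family_def)
  show "pairwise orthogonal (e ` I)"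
    using assms by (auto simp: orthonormal_family_def pairwise_def orthogonal_def)
  show "norm u = 1" if "u \<in> e ` I" for u
    using 1[OF that] by (simp add: norm_eq_1)
  show "0 \<notin> e ` I"
    using 1[of 0] by auto
qed

lemma dim_span_orthonormal_family:
  fixes e :: "'i \<Rightarrow> 'a::euclidean_space"
  assumes "orthonormal_family I e"
  shows "dim (span (e ` I)) = card I"
proof -
  have "independent (e ` I)"
    using orthonormal_family_image[OF assms] by (intro pairwise_orthogonal_independent)
  then show ?thesis
    using orthonormal_family_inj_on[OF assms]
    by (simp add: dim_eq_card_independent card_image)
qed

lemma orthonormal_expansion:
  fixes e :: "'i \<Rightarrow> 'a::euclidean_space"
  assumes "finite I" "orthonormal_family I e" "card I = DIM('a)"
  shows "(\<Sum>i\<in>I. (x \<bullet> e i) *\<^sub>R e i) = x"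
proof -
  have "span (e ` I) = UNIV"
    using dim_span_orthonormal_family[OF assms(2)] assms(3)
    by (metis dim_eq_full dim_span)
  then have "(\<Sum>u\<in>e ` I. (x \<bullet> u) *\<^sub>R u) = x"
    using orthonormal_family_image[OF assms(2)] assms(1)
    by (intro orthonormal_basis_expand) auto
  then show ?thesis
    by (simp add: sum.reindex[OF orthonormal_family_inj_on[OF assms(2)]])
qed

lemma inner_orthonormal_expansion:
  fixes e :: "'i \<Rightarrow> 'a::euclidean_space"
  assumes "finite I" "orthonormal_family I e" "card I = DIM('a)"
  shows "x \<bullet> y = (\<Sum>i\<in>I. (x \<bullet> e i) * (y \<bullet> e i))"
proof -
  have "x \<bullet> y = (\<Sum>i\<in>I. (x \<bullet> e i) *\<^sub>R e i) \<bullet> y"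
    using orthonormal_expansion[OF assms] by simp
  also have "\<dots> = (\<Sum>i\<in>I. (x \<bullet> e i) * (y \<bullet> e i))"
    by (simp add: inner_sum_left inner_commute[of "e _" y])
  finally show ?thesis .
qed

lemma parseval_identity:
  fixes e :: "'i \<Rightarrow> 'a::euclidean_space"
  assumes "finite I" "orthonormal_family I e" "card I = DIM('a)"
  shows "(norm x)\<^sup>2 = (\<Sum>i\<in>I. (x \<bullet> e i)\<^sup>2)"
  using inner_orthonormal_expansion[OF assms, of x x]
  unfolding power2_norm_eq_inner by (simp add: power2_eq_square)

text \<open>
  Both sides equal the corresponding sum for the adjoint over the standard basis of the target,
  which no longer mentions the orthonormal basis of the domain.
\<close>

lemma hilbert_schmidt_sum_independent_of_basis:
  fixes e :: "'i \<Rightarrow> 'a::euclidean_space" and u :: "'k \<Rightarrow> 'a"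
    and h :: "'a \<Rightarrow> 'b::euclidean_space"
  assumes "linear h"
    and "finite I" "orthonormal_family I e" "card I = DIM('a)"
    and "finite K" "orthonormal_family K u" "card K = DIM('a)"
  shows "(\<Sum>i\<in>I. (norm (h (e i)))\<^sup>2) = (\<Sum>k\<in>K. (norm (h (u k)))\<^sup>2)"
proof -
  have adj: "(\<Sum>i\<in>J. (norm (h (w i)))\<^sup>2) = (\<Sum>b\<in>Basis. (norm (adjoint h b))\<^sup>2)"
    if J: "finite J" "orthonormal_family J w" "card J = DIM('a)" for J :: "'j set" and w
  proof -
    have "(\<Sum>i\<in>J. (norm (h (w i)))\<^sup>2) = (\<Sum>i\<in>J. \<Sum>b\<in>Basis. (h (w i) \<bullet> b)\<^sup>2)"
      unfolding power2_norm_eq_inner euclidean_inner[of "h _" "h _"] by (simp add: power2_eq_square)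
    also have "\<dots> = (\<Sum>b\<in>Basis. \<Sum>i\<in>J. (adjoint h b \<bullet> w i)\<^sup>2)"
      using adjoint_works[OF assms(1)]
      by (subst sum.swap) (simp add: inner_commute)
    also have "\<dots> = (\<Sum>b\<in>Basis. (norm (adjoint h b))\<^sup>2)"
      using parseval_identity[OF J] by simp
    finally show ?thesis .
  qed
  show ?thesis
    using adj[OF assms(2-4)] adj[OF assms(5-7)] by simp
qed

section \<open>Low-rank approximation of a diagonal map\<close>

lemma diagonal_map_coefficient:
  fixes e :: "'i \<Rightarrow> 'a::euclidean_space"
  assumes "finite I" "orthonormal_family I e" "card I = DIM('a)"
    and "linear f" "\<And>i. i \<in> I \<Longrightarrow> f (e i) = mu i *\<^sub>R e i" "j \<in> I"
  shows "f x \<bullet> e j = mu j * (x \<bullet> e j)"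
proof -
  have "f x = f (\<Sum>i\<in>I. (x \<bullet> e i) *\<^sub>R e i)"
    using orthonormal_expansion[OF assms(1-3)] by simp
  also have "\<dots> = (\<Sum>i\<in>I. (x \<bullet> e i) *\<^sub>R mu i *\<^sub>R e i)"
    using assms(5) by (simp add: linear_sum[OF assms(4)] linear_cmul[OF assms(4)])
  finally have "f x \<bullet> e j = (\<Sum>i\<in>I. (x \<bullet> e i) * (mu i * (e i \<bullet> e j)))"
    by (simp add: inner_sum_left mult.assoc)
  also have "\<dots> = (\<Sum>i\<in>I. if i = j then (x \<bullet> e i) * mu i else 0)"
    using assms(2,6) by (intro sum.cong) (auto simp: orthonormal_family_def)
  also have "\<dots> = mu j * (x \<bullet> e j)"
    using assms(1,6) by simp
  finally show ?thesis .
qed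

lemma diagonal_map_norm_le:
  fixes e :: "'i \<Rightarrow> 'a::euclidean_space"
  assumes "finite I" "orthonormal_family I e" "card I = DIM('a)"
    and "linear f" "\<And>i. i \<in> I \<Longrightarrow> f (e i) = mu i *\<^sub>R e i"
    and "\<And>i. i \<in> I \<Longrightarrow> \<bar>mu i\<bar> \<le> t" "0 \<le> t"
  shows "norm (f x) \<le> t * norm x"
proof -
  have "(norm (f x))\<^sup>2 = (\<Sum>i\<in>I. (mu i)\<^sup>2 * (x \<bullet> e i)\<^sup>2)"
    using parseval_identity[OF assms(1-3), of "f x"] diagonal_map_coefficient[OF assms(1-5)]
    by (simp add: power_mult_distrib)
  also have "\<dots> \<le> (\<Sum>i\<in>I. t\<^sup>2 * (x \<bullet> e i)\<^sup>2)"
    using assms(6,7) by (intro sum_mono mult_right_mono) (auto simp: abs_le_square_iff[symmetric])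
  also have "\<dots> = (t * norm x)\<^sup>2"
    using parseval_identity[OF assms(1-3), of x]
    by (simp add: sum_distrib_left power_mult_distrib)
  finally show ?thesis
    by (rule power2_le_imp_le) (simp add: assms(7))
qed

text \<open>
  Moving from the weights \<open>c\<close> to the indicator function of \<open>I - J\<close> removes weight \<open>c i\<close> where
  \<open>a i \<ge> t\<close> and adds \<open>1 - c i\<close> where \<open>a i \<le> t\<close>; the total added does not exceed the total removed,
  so the weighted sum cannot grow.
\<close>

lemma sum_tail_le_weighted_sum:
  fixes a c :: "'i \<Rightarrow> real"
  assumes "finite I" "J \<subseteq> I"
    and "\<And>i. i \<in> J \<Longrightarrow> t \<le> a i" "\<And>i. i \<in> I - J \<Longrightarrow> a i \<le> t" "0 \<le> t"
    and "\<And>i. i \<in> I \<Longrightarrow> 0 \<le> c i" "\<And>i. i \<in> I \<Longrightarrow> c i \<le> 1"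
    and "real (card (I - J)) \<le> (\<Sum>i\<in>I. c i)"
  shows "(\<Sum>i\<in>I - J. a i) \<le> (\<Sum>i\<in>I. a i * c i)"
proof -
  have split: "(\<Sum>i\<in>I. g i) = (\<Sum>i\<in>J. g i) + (\<Sum>i\<in>I - J. g i)" for g :: "'i \<Rightarrow> real"
    using sum.subset_diff[OF assms(2,1), of g] by simp
  have "(\<Sum>i\<in>J. t * c i) \<le> (\<Sum>i\<in>J. a i * c i)"
    using assms by (intro sum_mono mult_right_mono) auto
  moreover have "(\<Sum>i\<in>I - J. a i * (1 - c i)) \<le> (\<Sum>i\<in>I - J. t * (1 - c i))"
    using assms by (intro sum_mono mult_right_mono) auto
  moreover have "(\<Sum>i\<in>I - J. t * (1 - c i)) = t * real (card (I - J)) - t * (\<Sum>i\<in>I - J. c i)"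
    by (simp add: right_diff_distrib sum_subtractf sum_distrib_left mult.commute)
  moreover have "(\<Sum>i\<in>J. t * c i) = t * (\<Sum>i\<in>J. c i)"
    by (simp add: sum_distrib_left)
  moreover have "t * real (card (I - J)) \<le> t * ((\<Sum>i\<in>J. c i) + (\<Sum>i\<in>I - J. c i))"
    using assms(5,8) split[of c] by (intro mult_left_mono) auto
  moreover have "(\<Sum>i\<in>I - J. a i * (1 - c i)) = (\<Sum>i\<in>I - J. a i) - (\<Sum>i\<in>I - J. a i * c i)"
    by (simp add: right_diff_distrib sum_subtractf)
  ultimately show ?thesis
    using split[of "\<lambda>i. a i * c i"] by (simp add: distrib_left)
qed

lemma dim_orthogonal_complement:
  fixes V :: "'a::euclidean_space set"
  assumes "subspace V"
  shows "dim {y. \<forall>x\<in>V. orthogonal x y} + dim V = DIM('a)"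
  using dim_subspace_orthogonal_to_vectors[OF assms subspace_UNIV] by simp

text \<open>
  Here \<open>J\<close> indexes the leading eigenvalues and \<open>t\<close> is a threshold that separates them from the
  others. The sum on the right is the squared Hilbert--Schmidt norm of \<open>f - g\<close>, computed in the
  eigenbasis of \<open>f\<close>; truncating \<open>f\<close> to \<open>J\<close> attains the bound.
\<close>

theorem eckart_young_hilbert_schmidt:
  fixes e :: "'i \<Rightarrow> 'a::euclidean_space"
  assumes I: "finite I" "orthonormal_family I e" "card I = DIM('a)"
    and f: "\<And>i. i \<in> I \<Longrightarrow> f (e i) = mu i *\<^sub>R e i"
    and J: "J \<subseteq> I" "\<And>i. i \<in> J \<Longrightarrow> t \<le> mu i"
      "\<And>i. i \<in> I - J \<Longrightarrow> 0 \<le> mu i \<and> mu i \<le> t" "0 \<le> t"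
    and g: "linear g" "dim (range g) \<le> card J"
  shows "(\<Sum>i\<in>I - J. (mu i)\<^sup>2) \<le> (\<Sum>i\<in>I. (norm (f (e i) - g (e i)))\<^sup>2)"
proof -
  let ?C = "{y. \<forall>x\<in>range g. orthogonal x y}"
  have "subspace ?C" by (rule subspace_orthogonal_to_vectors)
  obtain W where W: "W \<subseteq> ?C" "pairwise orthogonal W" "\<And>w. w \<in> W \<Longrightarrow> norm w = 1"
      "independent W" "card W = dim ?C"
    by (rule orthonormal_basis_subspace[OF \<open>subspace ?C\<close>]) (rule that)
  have finW: "finite W" using W(4) by (rule independent_imp_finite)
  have oW: "orthonormal_family W (\<lambda>w. w)"
    using W(2,3) by (auto simp: orthonormal_family_def pairwise_def orthogonal_def norm_eq_1)
  have cardW: "DIM('a) \<le> card W + card J"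
    using dim_orthogonal_complement[of "range g"] g W(5)
    by (simp add: linear_subspace_image[OF g(1) subspace_UNIV])
  \<comment> \<open>The squared length of the projection of \<open>e i\<close> to the span of \<open>W\<close>.\<close>
  define c where "c i = (\<Sum>w\<in>W. (e i \<bullet> w)\<^sup>2)" for i
  have c1: "c i \<le> 1" if "i \<in> I" for i
    using bessel_inequality[OF finW oW, of "e i"] I(2) that
    by (simp add: c_def orthonormal_family_def power2_norm_eq_inner)
  have sumc: "(\<Sum>i\<in>I. c i) = card W"
  proof -
    have "(\<Sum>i\<in>I. c i) = (\<Sum>w\<in>W. (norm w)\<^sup>2)"
      unfolding c_def using parseval_identity[OF I]
      by (subst sum.swap) (simp add: inner_commute)
    then show ?thesis using W(3) by simp
  qed
  have "(\<Sum>i\<in>I - J. (mu i)\<^sup>2) \<le> (\<Sum>i\<in>I. (mu i)\<^sup>2 * c i)"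
  proof (rule sum_tail_le_weighted_sum[where t = "t\<^sup>2"])
    show "real (card (I - J)) \<le> (\<Sum>i\<in>I. c i)"
      using cardW I J(1) sumc by (simp add: card_Diff_subset finite_subset)
    show "t\<^sup>2 \<le> (mu i)\<^sup>2" if "i \<in> J" for i
      using J(2)[OF that] J(4) by (simp add: power_mono)
    show "(mu i)\<^sup>2 \<le> t\<^sup>2" if "i \<in> I - J" for i
      using J(3)[OF that] by (simp add: power_mono)
    show "0 \<le> c i" for i
      by (simp add: c_def sum_nonneg)
  qed (use I(1) J(1) c1 in auto)
  also have "\<dots> \<le> (\<Sum>i\<in>I. (norm (f (e i) - g (e i)))\<^sup>2)"
  proof (rule sum_mono)
    fix i assume "i \<in> I"
    have "(mu i)\<^sup>2 * c i = (\<Sum>w\<in>W. ((f (e i) - g (e i)) \<bullet> w)\<^sup>2)"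
      unfolding c_def sum_distrib_left
    proof (rule sum.cong[OF refl])
      fix w assume "w \<in> W"
      then have "g (e i) \<bullet> w = 0" using W(1) by (auto simp: orthogonal_def)
      then show "(mu i)\<^sup>2 * (e i \<bullet> w)\<^sup>2 = ((f (e i) - g (e i)) \<bullet> w)\<^sup>2"
        using f[OF \<open>i \<in> I\<close>] by (simp add: inner_diff_left power_mult_distrib)
    qed
    also have "\<dots> \<le> (norm (f (e i) - g (e i)))\<^sup>2"
      by (rule bessel_inequality[OF finW oW])
    finally show "(mu i)\<^sup>2 * c i \<le> (norm (f (e i) - g (e i)))\<^sup>2" .
  qed
  finally show ?thesis .
qed

text \<open>
  The set \<open>K\<close> must be larger than the rank of \<open>g\<close>: then the span of its eigenvectors contains a
  nonzero \<open>w\<close> orthogonal to the range of \<open>g\<close>. Testing \<open>f - g\<close> on the vector \<open>f w\<close> (rather than on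
  \<open>w\<close>, where \<open>g\<close> need not vanish) gives
  \<open>\<parallel>f w\<parallel>\<^sup>2 = w \<bullet> f (f w) = w \<bullet> (f - g) (f w) \<le> \<parallel>w\<parallel> \<parallel>f - g\<parallel> \<parallel>f w\<parallel>\<close>.
\<close>

theorem eckart_young_operator_norm:
  fixes e :: "'i \<Rightarrow> 'a::euclidean_space"
  assumes I: "finite I" "orthonormal_family I e" "card I = DIM('a)"
    and f: "linear f" "\<And>i. i \<in> I \<Longrightarrow> f (e i) = mu i *\<^sub>R e i"
    and K: "K \<subseteq> I" "\<And>i. i \<in> K \<Longrightarrow> t \<le> mu i" "0 \<le> t"
    and g: "linear g" "dim (range g) < card K"
  shows "t \<le> onorm (\<lambda>x. f x - g x)"
proof -
  let ?C = "{y. \<forall>x\<in>range g. orthogonal x y}" and ?E = "span (e ` K)"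
  have oK: "orthonormal_family K e"
    using I(2) K(1) unfolding orthonormal_family_def by blast
  have "dim (?E \<inter> ?C) > 0"
  proof -
    have "dim {x + y |x y. x \<in> ?E \<and> y \<in> ?C} + dim (?E \<inter> ?C) = dim ?E + dim ?C"
      by (intro dim_sums_Int subspace_span subspace_orthogonal_to_vectors)
    moreover have "dim {x + y |x y. x \<in> ?E \<and> y \<in> ?C} \<le> DIM('a)"
      by (rule dim_subset_UNIV)
    moreover have "dim ?C + dim (range g) = DIM('a)"
      by (rule dim_orthogonal_complement) (simp add: linear_subspace_image[OF g(1) subspace_UNIV])
    ultimately show ?thesis
      using g(2) dim_span_orthonormal_family[OF oK] by linarith
  qed
  then obtain w where w: "w \<in> ?E" "w \<in> ?C" "w \<noteq> 0"
    using dim_eq_0[of "?E \<inter> ?C"] by (metis (no_types, lifting) IntE not_gr_zero singleton_iff subsetI)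
  have out: "w \<bullet> e i = 0" if "i \<in> I - K" for i
    using w(1)
  proof (induction rule: span_induct)
    case base
    then show ?case by (auto simp: subspace_def inner_add_left)
  next
    case (step x)
    then show ?case using I(2) K(1) that by (auto simp: orthonormal_family_def)
  qed
  have coef: "f x \<bullet> e i = mu i * (x \<bullet> e i)" if "i \<in> I" for x i
    using diagonal_map_coefficient[OF I f that] .
  have lower: "t * norm w \<le> norm (f w)"
  proof -
    have "(t * norm w)\<^sup>2 = (\<Sum>i\<in>I. t\<^sup>2 * (w \<bullet> e i)\<^sup>2)"
      using parseval_identity[OF I, of w] by (simp add: sum_distrib_left power_mult_distrib)
    also have "\<dots> \<le> (\<Sum>i\<in>I. (mu i)\<^sup>2 * (w \<bullet> e i)\<^sup>2)"
    proof (rule sum_mono)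
      fix i assume "i \<in> I"
      then show "t\<^sup>2 * (w \<bullet> e i)\<^sup>2 \<le> (mu i)\<^sup>2 * (w \<bullet> e i)\<^sup>2"
        using out[of i] K(2)[of i] K(3)
        by (cases "i \<in> K") (auto intro!: mult_right_mono power_mono)
    qed
    also have "\<dots> = (norm (f w))\<^sup>2"
      using parseval_identity[OF I, of "f w"] coef by (simp add: power_mult_distrib)
    finally show ?thesis by (rule power2_le_imp_le) simp
  qed
  have bl: "bounded_linear (\<lambda>x. f x - g x)"
    using f(1) g(1) by (simp add: linear_conv_bounded_linear bounded_linear_sub)
  \<comment> \<open>A map that is diagonal in an orthonormal basis is self-adjoint.\<close>
  have "f w \<bullet> f w = w \<bullet> f (f w)"
    using inner_orthonormal_expansion[OF I, of "f w" "f w"]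
      inner_orthonormal_expansion[OF I, of "w" "f (f w)"] coef
    by (simp add: algebra_simps)
  also have "\<dots> = w \<bullet> (f (f w) - g (f w))"
    using w(2) by (auto simp: inner_diff_right orthogonal_def inner_commute)
  also have "\<dots> \<le> norm w * norm (f (f w) - g (f w))"
    by (rule norm_cauchy_schwarz)
  also have "\<dots> \<le> norm w * (onorm (\<lambda>x. f x - g x) * norm (f w))"
    using onorm[OF bl, of "f w"] by (intro mult_left_mono) auto
  finally have "norm (f w) * norm (f w) \<le> (onorm (\<lambda>x. f x - g x) * norm w) * norm (f w)"
    by (simp add: power2_norm_eq_inner[symmetric] power2_eq_square mult_ac)
  then have "norm (f w) \<le> onorm (\<lambda>x. f x - g x) * norm w"
    using onorm_pos_le[OF bl] by (cases "f w = 0") auto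
  with lower have "t * norm w \<le> onorm (\<lambda>x. f x - g x) * norm w" by linarith
  then show ?thesis using w(3) by simp
qed

section \<open>Hermitian forms and congruence\<close>

text \<open>
  This identity makes \<open>complex^'n\<close> with its form a real Euclidean space; it is the bridge between
  the real theorems above and complex matrices.
\<close>

lemma inner_eq_Re_cinner: "x \<bullet> y = Re (cinner x y)"
  by (simp add: cinner_def inner_vec_def inner_complex_def)

lemma Re_cinner_self: "Re (cinner x x) = (norm x)\<^sup>2"
  by (simp add: inner_eq_Re_cinner[symmetric] power2_norm_eq_inner)

lemma cinner_scale_left: "cinner (a *s x) y = cnj a * cinner x y"
  by (simp add: cinner_def sum_distrib_left mult_ac)

lemma cinner_scale_right: "cinner x (a *s y) = a * cinner x y"
  by (simp add: cinner_def sum_distrib_left mult_ac)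

lemma cinner_add_right: "cinner x (y + z) = cinner x y + cinner x z"
  by (simp add: cinner_def distrib_left sum.distrib)

lemma cinner_sum_right: "cinner x (\<Sum>i\<in>I. f i) = (\<Sum>i\<in>I. cinner x (f i))"
  by (simp add: cinner_def sum_distrib_left) (rule sum.swap)

lemma cnj_cinner: "cnj (cinner x y) = cinner y x"
  by (simp add: cinner_def mult.commute)

lemma scaleR_eq_vector_scalar: "c *\<^sub>R x = complex_of_real c *s (x :: complex^'n)"
  by (simp add: vec_eq_iff scaleR_conv_of_real[where 'a = complex])

lemma cinner_matrix_vector_mult:
  "cinner x (M *v y) = cinner (conj_transpose M *v x) y"
proof -
  have "cinner x (M *v y) = (\<Sum>i\<in>UNIV. \<Sum>j\<in>UNIV. cnj (x $ i) * (M $ i $ j * y $ j))"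
    by (simp add: cinner_def matrix_vector_mult_def sum_distrib_left)
  also have "\<dots> = (\<Sum>j\<in>UNIV. \<Sum>i\<in>UNIV. cnj (x $ i) * (M $ i $ j * y $ j))"
    by (rule sum.swap)
  also have "\<dots> = cinner (conj_transpose M *v x) y"
    by (simp add: cinner_def conj_transpose_def matrix_vector_mult_def sum_distrib_right
        sum_distrib_left mult_ac)
  finally show ?thesis .
qed

lemma conj_transpose_conj_transpose [simp]: "conj_transpose (conj_transpose M) = M"
  by (simp add: conj_transpose_def vec_eq_iff)

lemma conj_transpose_mat_1 [simp]: "conj_transpose (mat 1) = mat 1"
  by (auto simp: conj_transpose_def mat_def vec_eq_iff)

lemma conj_transpose_add: "conj_transpose (M + N) = conj_transpose M + conj_transpose N"
  by (simp add: conj_transpose_def vec_eq_iff)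

lemma conj_transpose_matrix_mult:
  "conj_transpose (M ** N) = conj_transpose N ** conj_transpose M"
  by (simp add: conj_transpose_def matrix_matrix_mult_def vec_eq_iff mult.commute)

lemma matrix_mult_add_rdistrib: "(M + N) ** K = M ** K + N ** (K :: complex^'n^'m)"
  by (simp add: vec_eq_iff matrix_matrix_mult_def distrib_right sum.distrib)

lemma matrix_mult_diff_ldistrib: "K ** (M - N) = K ** M - K ** (N :: complex^'n^'m)"
  by (simp add: vec_eq_iff matrix_matrix_mult_def right_diff_distrib sum_subtractf)

lemma matrix_mult_diff_rdistrib: "(M - N) ** K = M ** K - N ** (K :: complex^'n^'m)"
  by (simp add: vec_eq_iff matrix_matrix_mult_def left_diff_distrib sum_subtractf)

lemma hermitian_psd_congruence:
  assumes "hermitian_psd B"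
  shows "hermitian_psd (M ** B ** conj_transpose M)"
proof -
  have "Re (cinner x ((M ** B ** conj_transpose M) *v x)) \<ge> 0" for x
    using assms
    by (simp add: hermitian_psd_def cinner_matrix_vector_mult[of x M] matrix_vector_mul_assoc[symmetric])
  then show ?thesis
    using assms
    by (simp add: hermitian_psd_def hermitian_def conj_transpose_matrix_mult matrix_mul_assoc)
qed

lemma hermitian_pd_congruence_identity_add_psd:
  assumes "hermitian_psd X" "invertible Q"
  shows "hermitian_pd (Q ** (mat 1 + X) ** conj_transpose Q)"
proof -
  have "Re (cinner x ((Q ** (mat 1 + X) ** conj_transpose Q) *v x)) > 0" if "x \<noteq> 0" for x
  proof -
    let ?y = "conj_transpose Q *v x"
    obtain R where "Q ** R = mat 1" using assms(2) by (auto simp: invertible_def)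
    then have "conj_transpose R ** conj_transpose Q = mat 1"
      by (metis conj_transpose_mat_1 conj_transpose_matrix_mult)
    then have "?y \<noteq> 0"
      using that by (metis matrix_vector_mul_assoc matrix_vector_mul_lid matrix_vector_mult_0_right)
    have "cinner x ((Q ** (mat 1 + X) ** conj_transpose Q) *v x) = cinner ?y ?y + cinner ?y (X *v ?y)"
      by (simp add: cinner_matrix_vector_mult[of x Q] matrix_vector_mul_assoc[symmetric]
          matrix_vector_mult_add_rdistrib cinner_add_right)
    moreover have "Re (cinner ?y (X *v ?y)) \<ge> 0"
      using assms(1) by (simp add: hermitian_psd_def)
    moreover have "Re (cinner ?y ?y) > 0"
      using \<open>?y \<noteq> 0\<close> by (simp add: Re_cinner_self)
    ultimately show ?thesis by simp
  qed
  then show ?thesis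
    using assms(1)
    by (simp add: hermitian_pd_def hermitian_psd_def hermitian_def conj_transpose_matrix_mult
        conj_transpose_add matrix_mul_assoc)
qed

text \<open>
  A positive definite matrix has trivial kernel, hence is invertible, and its inverse provides a
  right inverse of the left factor.
\<close>

lemma invertible_of_hermitian_pd_factor:
  fixes Q M :: "complex^'n^'n"
  assumes "hermitian_pd (Q ** M)"
  shows "invertible Q"
proof -
  have "x = 0" if "(Q ** M) *v x = 0" for x
    using assms that by (force simp: hermitian_pd_def cinner_def)
  then obtain R where "R ** (Q ** M) = mat 1"
    using matrix_left_invertible_ker by metis
  then have "Q ** (M ** R) = mat 1"
    by (metis matrix_left_right_inverse matrix_mul_assoc)
  then show ?thesis using invertible_right_inverse by blast
qed

lemma matrix_inv_mult:
  assumes "invertible Q"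
  shows "Q ** matrix_inv Q = mat 1" "matrix_inv Q ** Q = mat 1"
  using assms someI_ex[of "\<lambda>R. Q ** R = mat 1 \<and> R ** Q = mat 1"]
  by (auto simp: invertible_def matrix_inv_def)

section \<open>Sums of rank-one projections and rank\<close>

lemma sum_outer_self_mult:
  "(\<Sum>k\<in>K. lam k *\<^sub>R outer_self (v k)) *v x = (\<Sum>k\<in>K. (complex_of_real (lam k) * cinner (v k) x) *s v k)"
proof (induction K rule: infinite_finite_induct)
  case (insert k K)
  have "(lam k *\<^sub>R outer_self (v k)) *v x = (complex_of_real (lam k) * cinner (v k) x) *s v k"
    by (simp add: vec_eq_iff outer_self_def cinner_def matrix_vector_mult_def sum_distrib_left
        sum_distrib_right scaleR_conv_of_real[where 'a = complex] mult_ac)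
  with insert show ?case
    by (simp add: matrix_vector_mult_add_rdistrib)
qed auto

lemma hermitian_psd_sum_outer_self:
  assumes "\<And>k. k \<in> K \<Longrightarrow> 0 \<le> lam k"
  shows "hermitian_psd (\<Sum>k\<in>K. lam k *\<^sub>R outer_self (v k))"
proof -
  have "hermitian (\<Sum>k\<in>K. lam k *\<^sub>R outer_self (v k))"
    by (simp add: hermitian_def conj_transpose_def outer_self_def vec_eq_iff mult.commute)
  moreover have "0 \<le> Re (cinner x ((\<Sum>k\<in>K. lam k *\<^sub>R outer_self (v k)) *v x))" for x
  proof -
    have "cinner x ((\<Sum>k\<in>K. lam k *\<^sub>R outer_self (v k)) *v x) =
        (\<Sum>k\<in>K. complex_of_real (lam k) * (cinner (v k) x * cnj (cinner (v k) x)))"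
      by (simp add: sum_outer_self_mult cinner_sum_right cinner_scale_right cnj_cinner mult.assoc)
    also have "Re \<dots> = (\<Sum>k\<in>K. lam k * (cmod (cinner (v k) x))\<^sup>2)"
      by (simp add: complex_norm_square[symmetric])
    finally show ?thesis
      using assms by (simp add: sum_nonneg)
  qed
  ultimately show ?thesis by (simp add: hermitian_psd_def)
qed

lemma rank_sum_outer_self_le:
  assumes "finite K"
  shows "rank (\<Sum>k\<in>K. lam k *\<^sub>R outer_self (v k)) \<le> card K"
proof -
  let ?w = "\<lambda>k. \<chi> j. cnj (v k $ j)"
  have "row i (\<Sum>k\<in>K. lam k *\<^sub>R outer_self (v k)) = (\<Sum>k\<in>K. (complex_of_real (lam k) * v k $ i) *s ?w k)" for i
    by (simp add: row_def outer_self_def vec_eq_iff scaleR_conv_of_real[where 'a = complex] mult.assoc)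
  then have "rows (\<Sum>k\<in>K. lam k *\<^sub>R outer_self (v k)) \<subseteq> vec.span (?w ` K)"
    by (auto simp: rows_def intro!: vec.span_sum vec.span_scale intro: vec.span_base)
  then have "rank (\<Sum>k\<in>K. lam k *\<^sub>R outer_self (v k)) \<le> card (?w ` K)"
    unfolding row_rank_def_gen using assms by (intro vec.dim_le_card) auto
  also have "\<dots> \<le> card K" using assms by (rule card_image_le)
  finally show ?thesis .
qed

text \<open>
  The function \<open>rank\<close> is the dimension of the row space, whereas the approximation theorems need
  the dimension of the range. Writing every row as a combination of \<open>rank X\<close> basis rows
  factors \<open>X\<close> and exhibits as many vectors \<open>C b\<close> whose complex span contains the range; over the
  reals, \<open>C b\<close> and \<open>\<i> C b\<close> span it.
\<close>

lemma real_dim_range_le_twice_rank: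
  fixes X :: "complex^'n^'m"
  shows "dim (range (\<lambda>x. X *v x)) \<le> 2 * rank X"
proof -
  obtain B where B: "B \<subseteq> rows X" "vec.independent B" "rows X \<subseteq> vec.span B" "card B = rank X"
    unfolding row_rank_def_gen by (rule vec.basis_exists)
  have fin: "finite B" using B(2) by (rule vec.finiteI_independent)
  have "\<exists>c. row i X = (\<Sum>b\<in>B. c b *s b)" for i
  proof -
    have "row i X \<in> vec.span B" using B(3) by (auto simp: rows_def)
    then show ?thesis by (auto simp: vec.span_finite[OF fin])
  qed
  then obtain c where c: "\<And>i. row i X = (\<Sum>b\<in>B. c i b *s b)" by metis
  define C where "C b = (\<chi> i. c i b)" for b
  have "X *v x = (\<Sum>b\<in>B. (\<Sum>j\<in>UNIV. b $ j * x $ j) *s C b)" for x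
  proof -
    have "(X *v x) $ i = (\<Sum>b\<in>B. (\<Sum>j\<in>UNIV. b $ j * x $ j) *s C b) $ i" for i
    proof -
      have "(X *v x) $ i = (\<Sum>j\<in>UNIV. row i X $ j * x $ j)"
        by (simp add: matrix_vector_mult_def row_def)
      also have "\<dots> = (\<Sum>j\<in>UNIV. \<Sum>b\<in>B. c i b * b $ j * x $ j)"
        by (simp add: c sum_distrib_right)
      also have "\<dots> = (\<Sum>b\<in>B. \<Sum>j\<in>UNIV. c i b * b $ j * x $ j)"
        by (rule sum.swap)
      finally show ?thesis
        by (simp add: C_def sum_distrib_left sum_distrib_right mult_ac)
    qed
    then show ?thesis by (simp add: vec_eq_iff)
  qed
  moreover have "z *s C b \<in> span ((\<lambda>(b, u). u *s C b) ` (B \<times> Basis))" if "b \<in> B" for z b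
  proof -
    have "z *s C b = Re z *\<^sub>R (1 *s C b) + Im z *\<^sub>R (\<i> *s C b)"
      by (simp add: vec_eq_iff complex_eq_iff)
    moreover have "u *s C b \<in> span ((\<lambda>(b, u). u *s C b) ` (B \<times> Basis))" if "u \<in> Basis" for u :: complex
      using \<open>b \<in> B\<close> that by (intro span_base) auto
    ultimately show ?thesis
      by (metis Basis_complex_def insertI1 insertI2 span_add span_scale)
  qed
  ultimately have "range (\<lambda>x. X *v x) \<subseteq> span ((\<lambda>(b, u). u *s C b) ` (B \<times> Basis))"
    by (auto intro!: span_sum)
  then have "dim (range (\<lambda>x. X *v x)) \<le> card ((\<lambda>(b, u). u *s C b) ` (B \<times> (Basis :: complex set)))"
    using fin by (intro dim_le_card) auto
  also have "\<dots> \<le> card (B \<times> (Basis :: complex set))"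
    using fin by (intro card_image_le) auto
  finally show ?thesis using B(4) by (simp add: card_cartesian_product mult.commute)
qed

section \<open>The Eckart--Young theorem for complex matrices\<close>

text \<open>
  As \<open>Basis\<close> of the complex numbers is \<open>{1, \<i>}\<close>, a complex orthonormal family \<open>v\<close> becomes the real
  orthonormal family of all \<open>v i\<close> and \<open>\<i> v i\<close>, twice as large.
\<close>

lemma orthonormal_family_realification:
  assumes "\<And>i j. i \<in> I \<Longrightarrow> j \<in> I \<Longrightarrow> cinner (v i) (v j) = (if i = j then 1 else 0)"
  shows "orthonormal_family (I \<times> Basis) (\<lambda>(i, u). u *s v i)"
proof -
  have "(a *s v i) \<bullet> (b *s v j) = (if (i, a) = (j, b) then 1 else 0)"
    if "i \<in> I" "j \<in> I" "a \<in> Basis" "b \<in> Basis" for i j a b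
    using assms[OF that(1,2)] that(3,4)
    by (auto simp: inner_eq_Re_cinner cinner_scale_left cinner_scale_right Basis_complex_def)
  then show ?thesis
    by (auto simp: orthonormal_family_def)
qed

lemma cinner_axis: "cinner (axis i 1) (axis j 1) = (if i = j then 1 else 0)"
proof -
  have "cinner (axis i 1) (axis j 1) = (\<Sum>k\<in>UNIV. if k = j then if i = j then 1 else 0 else 0)"
    unfolding cinner_def by (intro sum.cong) (auto simp: axis_def)
  then show ?thesis by simp
qed

text \<open>
  The right side may be computed in the standard basis instead, where the terms for
  \<open>axis j 1\<close> and \<open>\<i> axis j 1\<close> both equal the squared length of column \<open>j\<close>; hence the factor 2.
\<close>

lemma frobenius_norm_eq_realified_hilbert_schmidt:
  fixes M :: "complex^'n^'n"
  assumes "finite I" "card I = CARD('n)"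
    and "\<And>i j. i \<in> I \<Longrightarrow> j \<in> I \<Longrightarrow> cinner (v i) (v j) = (if i = j then 1 else 0)"
  shows "2 * (frobenius_norm M)\<^sup>2 = (\<Sum>(i, u)\<in>I \<times> Basis. (norm (M *v (u *s v i)))\<^sup>2)"
proof -
  have unit: "(norm (M *v (u *s axis j 1)))\<^sup>2 = (\<Sum>i\<in>UNIV. (cmod (M $ i $ j))\<^sup>2)"
    if "u \<in> Basis" for u and j :: 'n
  proof -
    have "M *v (u *s axis j 1) = u *s column j M"
      by (simp add: vec_eq_iff matrix_vector_mult_def axis_def column_def if_distrib mult.commute cong: if_cong)
    moreover have "cmod u = 1" using that by (rule norm_Basis)
    ultimately show ?thesis
      by (simp add: norm_vec_def L2_set_def sum_nonneg column_def norm_mult)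
  qed
  have "(\<Sum>(i, u)\<in>I \<times> Basis. (norm (M *v (u *s v i)))\<^sup>2) =
      (\<Sum>p\<in>I \<times> Basis. (norm (M *v (case p of (i, u) \<Rightarrow> u *s v i)))\<^sup>2)"
    by (simp add: case_prod_beta)
  also have "\<dots> = (\<Sum>p\<in>(UNIV :: 'n set) \<times> Basis. (norm (M *v (case p of (j, u) \<Rightarrow> u *s axis j 1)))\<^sup>2)"
  proof (rule hilbert_schmidt_sum_independent_of_basis[where h = "\<lambda>x. M *v x"])
    show "orthonormal_family (I \<times> Basis) (\<lambda>(i, u). u *s v i)"
      by (rule orthonormal_family_realification) (rule assms(3))
    show "orthonormal_family ((UNIV :: 'n set) \<times> Basis) (\<lambda>(j, u). u *s axis j (1 :: complex))"
      by (rule orthonormal_family_realification) (rule cinner_axis)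
  qed (use assms(1,2) in auto)
  also have "\<dots> = (\<Sum>p\<in>(UNIV :: 'n set) \<times> (Basis :: complex set). \<Sum>i\<in>UNIV. (cmod (M $ i $ fst p))\<^sup>2)"
    by (intro sum.cong) (auto simp: unit)
  also have "\<dots> = (\<Sum>j\<in>UNIV. \<Sum>u\<in>(Basis :: complex set). \<Sum>i\<in>UNIV. (cmod (M $ i $ j))\<^sup>2)"
    by (subst sum.cartesian_product) (simp add: case_prod_beta)
  also have "\<dots> = 2 * (\<Sum>j\<in>UNIV. \<Sum>i\<in>UNIV. (cmod (M $ i $ j))\<^sup>2)"
    by (simp add: sum_distrib_left)
  also have "\<dots> = 2 * (frobenius_norm M)\<^sup>2"
    by (subst sum.swap) (simp add: frobenius_norm_def sum_nonneg)
  finally show ?thesis by simp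
qed

text \<open>
  The difference \<open>G - G\<^sub>r\<close> is diagonal in the same basis, with the leading \<open>r\<close> eigenvalues replaced by
  0. Its norms are therefore at most the lower bounds that the real theorems give for
  \<open>G - X\<close>, with \<open>lam r\<close> as the threshold.
\<close>

theorem eckart_young_complex:
  fixes G X :: "complex^'n^'n"
  assumes dec: "eigen_decomposition G lam v" and nonneg: "\<And>i. i < CARD('n) \<Longrightarrow> 0 \<le> lam i"
    and r: "r < CARD('n)" and X: "rank X \<le> r"
  defines "G\<^sub>r \<equiv> \<Sum>i<r. lam i *\<^sub>R outer_self (v i)"
  shows "spectral_norm (G - G\<^sub>r) \<le> spectral_norm (G - X)"
    and "frobenius_norm (G - G\<^sub>r) \<le> frobenius_norm (G - X)"
proof -
  let ?I = "{..<CARD('n)} \<times> (Basis :: complex set)" and ?J = "{..<r} \<times> (Basis :: complex set)"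
  define e where "e = (\<lambda>(i, u). u *s v i)"
  define mu where "mu = (\<lambda>(i, u :: complex). lam i)"
  have on: "\<And>i j. i \<in> {..<CARD('n)} \<Longrightarrow> j \<in> {..<CARD('n)} \<Longrightarrow> cinner (v i) (v j) = (if i = j then 1 else 0)"
    and eig: "\<And>i. i < CARD('n) \<Longrightarrow> G *v v i = complex_of_real (lam i) *s v i"
    and anti: "\<And>i j. i < CARD('n) \<Longrightarrow> j < CARD('n) \<Longrightarrow> i \<le> j \<Longrightarrow> lam j \<le> lam i"
    using dec by (auto simp: eigen_decomposition_def)
  have I: "finite ?I" "orthonormal_family ?I e" "card ?I = DIM(complex^'n)"
    using orthonormal_family_realification[OF on] by (auto simp: e_def)
  have scale: "M *v (u *s x) = u *s (M *v x)" for M :: "complex^'n^'n" and u x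
    by (simp add: vec.scale)
  have Ge: "G *v e p = mu p *\<^sub>R e p" if "p \<in> ?I" for p
    using that eig by (auto simp: e_def mu_def scale scaleR_eq_vector_scalar mult.commute)
  have Gr_v: "G\<^sub>r *v v j = (if j < r then complex_of_real (lam j) *s v j else 0)" if "j < CARD('n)" for j
  proof -
    have "G\<^sub>r *v v j = (\<Sum>k<r. if j = k then complex_of_real (lam j) *s v j else 0)"
      unfolding G\<^sub>r_def sum_outer_self_mult using on that r by (intro sum.cong) auto
    then show ?thesis by simp
  qed
  define nu where "nu p = (if p \<in> ?J then 0 else mu p)" for p
  have De: "(G - G\<^sub>r) *v e p = nu p *\<^sub>R e p" if pI: "p \<in> ?I" for p
  proof -
    obtain i u where p: "p = (i, u)" "i < CARD('n)" "u \<in> Basis"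
      using pI by auto
    have "(G - G\<^sub>r) *v e p = u *s (complex_of_real (lam i) *s v i - G\<^sub>r *v v i)"
      using p(2) by (simp add: p(1) e_def matrix_vector_mult_diff_rdistrib scale eig vec.scale_right_diff_distrib)
    also have "\<dots> = nu p *\<^sub>R e p"
      using p by (simp add: Gr_v e_def nu_def mu_def scaleR_eq_vector_scalar mult.commute)
    finally show ?thesis .
  qed
  have J: "?J \<subseteq> ?I" "card ?J = 2 * r" using r by auto
  have head: "lam r \<le> mu p" if "p \<in> ?J \<union> {(r, 1)}" for p
    using that anti r by (auto simp: mu_def)
  have tail: "0 \<le> mu p \<and> mu p \<le> lam r" if "p \<in> ?I - ?J" for p
  proof -
    obtain i u where "p = (i, u)" "i < CARD('n)" "r \<le> i"
      using \<open>p \<in> ?I - ?J\<close> by (cases p) auto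
    then show ?thesis using anti[of r i] r nonneg by (simp add: mu_def)
  qed
  have dimX: "dim (range (\<lambda>x. X *v x)) \<le> card ?J"
    using real_dim_range_le_twice_rank[of X] X J(2) by linarith

  have "spectral_norm (G - G\<^sub>r) \<le> lam r"
    unfolding spectral_norm_def
  proof (rule onorm_le)
    show "norm ((G - G\<^sub>r) *v x) \<le> lam r * norm x" for x
    proof (rule diagonal_map_norm_le[OF I _ De])
      show "\<bar>nu p\<bar> \<le> lam r" if "p \<in> ?I" for p
        using tail[of p] that nonneg[OF r] by (auto simp: nu_def)
    qed (use nonneg[OF r] in auto)
  qed
  \<comment> \<open>One eigenvector beyond the leading \<open>2 r\<close> makes their span too large to miss the complement of the range.\<close>
  also have "lam r \<le> onorm (\<lambda>x. G *v x - X *v x)"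
  proof (rule eckart_young_operator_norm[OF I _ Ge])
    show "?J \<union> {(r, 1)} \<subseteq> ?I" using r by (auto simp: Basis_complex_def)
    show "dim (range (\<lambda>x. X *v x)) < card (?J \<union> {(r, 1)})"
      using dimX by simp
  qed (use head nonneg[OF r] in auto)
  also have "\<dots> = spectral_norm (G - X)"
    by (simp add: spectral_norm_def matrix_vector_mult_diff_rdistrib)
  finally show "spectral_norm (G - G\<^sub>r) \<le> spectral_norm (G - X)" .

  have frob: "2 * (frobenius_norm M)\<^sup>2 = (\<Sum>p\<in>?I. (norm (M *v e p))\<^sup>2)" for M :: "complex^'n^'n"
    using frobenius_norm_eq_realified_hilbert_schmidt[of "{..<CARD('n)}" v M] on
    by (simp add: e_def case_prod_beta)
  have "2 * (frobenius_norm (G - G\<^sub>r))\<^sup>2 = (\<Sum>p\<in>?I. (nu p)\<^sup>2)"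
    unfolding frob
  proof (rule sum.cong[OF refl])
    fix p assume p: "p \<in> ?I"
    then have "norm (e p) = 1"
      unfolding norm_eq_1 using I(2)[unfolded orthonormal_family_def, rule_format, OF p p] by simp
    then show "(norm ((G - G\<^sub>r) *v e p))\<^sup>2 = (nu p)\<^sup>2"
      by (simp add: De[OF p])
  qed
  also have "\<dots> = (\<Sum>p\<in>?I - ?J. (mu p)\<^sup>2)"
    using J(1) by (intro sum.mono_neutral_cong_right) (auto simp: nu_def)
  also have "\<dots> \<le> (\<Sum>p\<in>?I. (norm (G *v e p - X *v e p))\<^sup>2)"
    by (rule eckart_young_hilbert_schmidt[OF I Ge J(1) head tail nonneg[OF r] _ dimX]) auto
  also have "\<dots> = 2 * (frobenius_norm (G - X))\<^sup>2"
    by (simp add: frob matrix_vector_mult_diff_rdistrib)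
  finally show "frobenius_norm (G - G\<^sub>r) \<le> frobenius_norm (G - X)"
    by (intro power2_le_imp_le[of "frobenius_norm _" "frobenius_norm _"])
      (auto simp: frobenius_norm_def sum_nonneg)
qed

section \<open>The best low-rank correction of a positive definite matrix\<close>

theorem proposition3:
  fixes S A B Q G G\<^sub>r S\<^sub>r :: "complex^'n^'n"
    and r :: nat
    and nrm :: "complex^'n^'n \<Rightarrow> real"
  assumes "S = A + B"
    and "A = Q ** conj_transpose Q"
    and "hermitian_pd A"
    and "hermitian_psd B"
    and "G = matrix_inv Q ** B ** conj_transpose (matrix_inv Q)"
    and "0 < r" and "r < rank B"
    and "truncated_svd r G G\<^sub>r"
    and "S\<^sub>r = Q ** (mat 1 + G\<^sub>r) ** conj_transpose Q"
    and "nrm = spectral_norm \<or> nrm = frobenius_norm"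
  shows "is_arg_min
    (\<lambda>P. (nrm (matrix_inv Q ** (S - P) ** conj_transpose (matrix_inv Q)))\<^sup>2)
    (\<lambda>P. hermitian_pd P \<and>
      (\<exists>X. P = Q ** (mat 1 + X) ** conj_transpose Q \<and> rank X \<le> r))
    S\<^sub>r"
proof -
  let ?R = "matrix_inv Q"
  have inv: "invertible Q"
    using assms(2,3) invertible_of_hermitian_pd_factor by metis
  have RQ: "?R ** Q = mat 1" by (rule matrix_inv_mult(2)[OF inv])
  then have QR: "conj_transpose Q ** conj_transpose ?R = mat 1"
    by (metis conj_transpose_mat_1 conj_transpose_matrix_mult)
  have cancel: "?R ** (Q ** M ** conj_transpose Q) ** conj_transpose ?R = M" for M
  proof -
    have "?R ** (Q ** M ** conj_transpose Q) ** conj_transpose ?R =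
        (?R ** Q) ** M ** (conj_transpose Q ** conj_transpose ?R)"
      by (simp only: matrix_mul_assoc)
    then show ?thesis by (simp add: RQ QR)
  qed
  have objective: "?R ** (S - Q ** (mat 1 + X) ** conj_transpose Q) ** conj_transpose ?R = G - X" for X
  proof -
    have "S - Q ** (mat 1 + X) ** conj_transpose Q = B - Q ** X ** conj_transpose Q"
      by (simp add: assms(1,2) matrix_add_ldistrib matrix_mult_add_rdistrib)
    then show ?thesis
      using cancel[of X] by (simp add: assms(5) matrix_mult_diff_ldistrib matrix_mult_diff_rdistrib)
  qed
  obtain lam v where dec: "eigen_decomposition G lam v"
    and Gr: "G\<^sub>r = (\<Sum>i<r. lam i *\<^sub>R outer_self (v i))"
    using assms(8) by (auto simp: truncated_svd_def)
  have r: "r < CARD('n)"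
    using assms(7) vec.dim_subset_UNIV[of "rows B"] by (simp add: row_rank_def_gen vec.dimension_def card_cart_basis)
  have "hermitian_psd G"
    unfolding assms(5) by (rule hermitian_psd_congruence[OF assms(4)])
  have nonneg: "0 \<le> lam i" if "i < CARD('n)" for i
  proof -
    have "G *v v i = complex_of_real (lam i) *s v i" "cinner (v i) (v i) = 1"
      using dec that by (auto simp: eigen_decomposition_def)
    then have "cinner (v i) (G *v v i) = complex_of_real (lam i)"
      by (simp add: cinner_scale_right)
    then show ?thesis
      using \<open>hermitian_psd G\<close> by (metis Re_complex_of_real hermitian_psd_def)
  qed
  have "hermitian_pd S\<^sub>r"
    unfolding assms(9) Gr using nonneg r inv
    by (intro hermitian_pd_congruence_identity_add_psd hermitian_psd_sum_outer_self) auto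
  moreover have "rank G\<^sub>r \<le> r"
    unfolding Gr using rank_sum_outer_self_le[of "{..<r}" lam v] by simp
  moreover have "(nrm (G - G\<^sub>r))\<^sup>2 \<le> (nrm (G - X))\<^sup>2" if "rank X \<le> r" for X
  proof (rule power_mono)
    show "nrm (G - G\<^sub>r) \<le> nrm (G - X)"
      using assms(10) eckart_young_complex[OF dec nonneg r that] unfolding Gr by auto
    show "0 \<le> nrm (G - G\<^sub>r)"
      using assms(10) by (auto simp: spectral_norm_def frobenius_norm_def sum_nonneg onorm_pos_le)
  qed
  ultimately show ?thesis
    unfolding is_arg_min_def using assms(9) by (auto simp: objective not_less)
qed

end
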